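(* A permutation $\sigma\in\mathfrak S_n$ is shallow if and only if $\Phi(\sigma)$ avoids each of the three vincular patterns $5,24,13$; $4,25,13$; and $31,42$.
   Context: For $\sigma\in\mathfrak S_n$: the length $\ell_S(\sigma)$ is the number of inversions (pairs $i<j$ with $\sigma_i>\sigma_j$); the reflection length is $\ell_T(\sigma)=n-(\text{number of cycles of }\sigma)$; the depth is $\mathrm{dp}(\sigma)=\sum_{i:\sigma_i>i}(\sigma_i-i)$. The permutation $\sigma$ is called shallow if $\mathrm{dp}(\sigma)=(\ell_S(\sigma)+\ell_T(\sigma))/2$. The fundamental bijection $\Phi$: write $\sigma$ in cycle notation with each cycle beginning with its largest element, and with the cycles ordered left to right by increasing largest element; erasing the parentheses gives a word which is the one-line notation of the permutation $\Phi(\sigma)\in\mathfrak S_n$. A vincular pattern is a permutation $\pi\in\mathfrak S_k$ in one-line notation divided into consecutive blocks, written with blocks separated by commas (e.g. $5,24,13$ has blocks $5$, $24$, $13$). An occurrence of it in $\tau\in\mathfrak S_n$ is a choice of positions $i_1<\dots<i_k$ such that $\tau_{i_1}\cdots\tau_{i_k}$ is order-isomorphic to $\pi$ and, whenever $\pi_r,\pi_{r+1}$ lie in the same block, $i_{r+1}=i_r+1$. The permutation $\tau$ avoids the pattern if it has no occurrence. *)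

theory Defs
  imports Complex_Main "HOL-Combinatorics.Combinatorics"
begin

text \<open>
  Elements of the symmetric group on \<open>n\<close> letters are functions \<open>\<sigma> :: nat \<Rightarrow> nat\<close>
  with \<open>\<sigma> permutes {1..n}\<close>.
\<close>

definition inversion_length :: "nat \<Rightarrow> (nat \<Rightarrow> nat) \<Rightarrow> nat" where
  "inversion_length n \<sigma> = card {(i, j). i \<in> {1..n} \<and> j \<in> {1..n} \<and> i < j \<and> \<sigma> i > \<sigma> j}"

text \<open>Fixed points count as cycles.\<close>

definition cycle_sets :: "nat \<Rightarrow> (nat \<Rightarrow> nat) \<Rightarrow> nat set set" where
  "cycle_sets n \<sigma> = orbit \<sigma> ` {1..n}"

text \<open>There are at most \<open>n\<close> cycles, so the subtraction on \<open>nat\<close> does not truncate.\<close>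

definition reflection_length :: "nat \<Rightarrow> (nat \<Rightarrow> nat) \<Rightarrow> nat" where
  "reflection_length n \<sigma> = n - card (cycle_sets n \<sigma>)"

definition depth :: "nat \<Rightarrow> (nat \<Rightarrow> nat) \<Rightarrow> nat" where
  "depth n \<sigma> = (\<Sum>i\<in>{i \<in> {1..n}. \<sigma> i > i}. \<sigma> i - i)"

definition shallow :: "nat \<Rightarrow> (nat \<Rightarrow> nat) \<Rightarrow> bool" where
  "shallow n \<sigma> \<longleftrightarrow>
     real (depth n \<sigma>) = (real (inversion_length n \<sigma>) + real (reflection_length n \<sigma>)) / 2"

text \<open>
  For a permutation, \<open>support \<sigma> m\<close> is the list \<open>[m, \<sigma> m, \<sigma> (\<sigma> m), \<dots>]\<close>
  running once through the cycle of \<open>m\<close>. A cycle is determined by its largest element, so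
  listing these maxima in increasing order lists the cycles in the required order.
\<close>

definition fundamental_word :: "nat \<Rightarrow> (nat \<Rightarrow> nat) \<Rightarrow> nat list" where
  "fundamental_word n \<sigma> = concat (map (support \<sigma>) (sorted_list_of_set (Max ` cycle_sets n \<sigma>)))"

definition fundamental_bij :: "nat \<Rightarrow> (nat \<Rightarrow> nat) \<Rightarrow> (nat \<Rightarrow> nat)" where
  "fundamental_bij n \<sigma> = (\<lambda>i. if i \<in> {1..n} then fundamental_word n \<sigma> ! (i - 1) else i)"

text \<open>
  A vincular pattern is the list of its blocks; for instance \<open>5,24,13\<close> is
  \<open>[[5], [2, 4], [1, 3]]\<close>. Positions in the underlying word \<open>concat bs\<close> are
  counted from \<open>0\<close>.
\<close>

definition same_block :: "'a list list \<Rightarrow> nat \<Rightarrow> nat \<Rightarrow> bool" where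
  "same_block bs r s \<longleftrightarrow>
     (\<exists>us b vs. bs = us @ b # vs \<and>
        {r, s} \<subseteq> {length (concat us) ..< length (concat us) + length b})"

text \<open>\<open>ps\<close> is the list of positions \<open>i\<^sub>1 < \<dots> < i\<^sub>k\<close> of the occurrence.\<close>

definition vincular_occurrence ::
    "nat \<Rightarrow> (nat \<Rightarrow> nat) \<Rightarrow> nat list list \<Rightarrow> nat list \<Rightarrow> bool" where
  "vincular_occurrence n \<tau> bs ps \<longleftrightarrow>
     (let \<pi> = concat bs; k = length \<pi> in
        length ps = k \<and> set ps \<subseteq> {1..n} \<and> sorted_wrt (<) ps \<and>
        (\<forall>r<k. \<forall>s<k. \<tau> (ps ! r) < \<tau> (ps ! s) \<longleftrightarrow> \<pi> ! r < \<pi> ! s) \<and>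
        (\<forall>r. Suc r < k \<longrightarrow> same_block bs r (Suc r) \<longrightarrow> ps ! Suc r = ps ! r + 1))"

definition vincular_avoids :: "nat \<Rightarrow> (nat \<Rightarrow> nat) \<Rightarrow> nat list list \<Rightarrow> bool" where
  "vincular_avoids n \<tau> bs \<longleftrightarrow> \<not> (\<exists>ps. vincular_occurrence n \<tau> bs ps)"

end

theory Submission
  imports Defs
begin

text \<open>
  Let \<open>deficit = 2 dp - \<ell>\<^sub>S - \<ell>\<^sub>T\<close>. Delete the smallest letter \<open>t\<close> from its cycle
  \<open>\<dots> j \<rightarrow> t \<rightarrow> m \<dots>\<close>, so that \<open>j \<rightarrow> m\<close>. The deficit drops by \<open>2 min \<alpha> \<beta>\<close>, where \<open>\<alpha>\<close> and \<open>\<beta>\<close>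
  count the arcs \<open>(a, b)\<close> with \<open>a < j\<close>, \<open>b > m\<close> and with \<open>a > j\<close>, \<open>b < m\<close>, respectively, and
  \<open>\<alpha> - \<beta> = j - m\<close>. On the other side, avoidance of the three patterns by \<open>\<Phi>(\<sigma>)\<close> says that there are
  no \<open>a\<close> before \<open>c\<close> in the word with \<open>c < a < \<sigma> c < \<sigma> a\<close> or \<open>\<sigma> a < \<sigma> c < a < c\<close>. Since the word
  has to pass from letters above a level to letters below it through a single arc, and conversely,
  this condition holds before the deletion of \<open>t\<close> if and only if it holds afterwards and
  \<open>min \<alpha> \<beta> = 0\<close>. Both conditions therefore agree by induction.
\<close>

subsection \<open>Arcs of a word\<close>

definition next_val :: "nat \<Rightarrow> nat list \<Rightarrow> nat" where
  "next_val M ys = (case ys of [] \<Rightarrow> M | y # _ \<Rightarrow> min y M)"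

lemma next_val_simps [simp]: "next_val M [] = M" "next_val M (y # ys) = min y M"
  by (simp_all add: next_val_def)

text \<open>
  In the word \<open>\<Phi>(\<sigma>)\<close> the image of a letter is the next letter, unless that one opens a new
  cycle, i.e. exceeds everything read so far; then the image is the maximum read so far.
  Hence \<open>arcs 0 \<Phi>(\<sigma>)\<close> lists the pairs \<open>(x, \<sigma> x)\<close> in word order, with \<open>M\<close> the running maximum;
  \<open>arcs_upto M xs j\<close> is its part for a prefix \<open>xs\<close> followed by \<open>j\<close>.
\<close>

fun arcs :: "nat \<Rightarrow> nat list \<Rightarrow> (nat \<times> nat) list" where
  "arcs M [] = []"
| "arcs M (x # xs) = (x, next_val (max M x) xs) # arcs (max M x) xs"

fun arcs_upto :: "nat \<Rightarrow> nat list \<Rightarrow> nat \<Rightarrow> (nat \<times> nat) list" where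
  "arcs_upto M [] j = []"
| "arcs_upto M (x # xs) j = (x, next_val (max M x) (xs @ [j])) # arcs_upto (max M x) xs j"

fun lr_maxima :: "nat \<Rightarrow> nat list \<Rightarrow> nat" where
  "lr_maxima M [] = 0"
| "lr_maxima M (x # xs) = (if M < x then 1 else 0) + lr_maxima (max M x) xs"

text \<open>The two arcs cross, in the wrong word order: \<open>p\<close> is meant to precede \<open>q\<close>.\<close>

definition cross :: "nat \<times> nat \<Rightarrow> nat \<times> nat \<Rightarrow> bool" where
  "cross p q \<longleftrightarrow> fst q < fst p \<and> fst p < snd q \<and> snd q < snd p \<or>
               snd p < snd q \<and> snd q < fst p \<and> fst p < fst q"

abbreviation uncrossed :: "(nat \<times> nat) list \<Rightarrow> bool" where
  "uncrossed \<equiv> sorted_wrt (\<lambda>p q. \<not> cross p q)"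

lemma map_fst_arcs [simp]: "map fst (arcs M w) = w"
  by (induction M w rule: arcs.induct) auto

lemma map_fst_arcs_upto [simp]: "map fst (arcs_upto M xs j) = xs"
  by (induction M xs j rule: arcs_upto.induct) auto

lemma fst_set_arcs: "fst ` set (arcs M w) = set w"
  by (metis list.set_map map_fst_arcs)

lemma fst_set_arcs_upto: "fst ` set (arcs_upto M xs j) = set xs"
  by (metis list.set_map map_fst_arcs_upto)

lemma arcs_append:
  "arcs M (xs @ j # ys) = arcs_upto M xs j @ arcs (fold max xs M) (j # ys)"
proof (induction xs arbitrary: M)
  case (Cons x xs)
  then show ?case by (cases xs) (auto simp: max.commute)
qed simp

text \<open>At each step the running maximum and the next letter are split into their minimum, which
  becomes an image, and their maximum, which is carried on; the last arc releases the final
  maximum.\<close>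

lemma mset_snd_arcs_Cons:
  "mset (map snd (arcs M (x # xs))) = add_mset (max M x) (mset xs)"
proof (induction xs arbitrary: M x)
  case (Cons y ys)
  have "mset (map snd (arcs M (x # y # ys))) =
          add_mset (min y (max M x)) (add_mset (max (max M x) y) (mset ys))"
    using Cons[of "max M x" y] by simp
  then show ?case
    by (cases "y \<le> max M x") (auto simp: min_def max_def)
qed simp

lemma mset_snd_arcs: "mset (map snd (arcs 0 w)) = mset w"
  by (cases w) (simp_all only: mset_snd_arcs_Cons, simp_all)

section \<open>Arcs across a level \<open>v\<close> missing from the letters read\<close>

lemma arcs_upto_descent:
  assumes "v < x" "k < v" "k \<in> set us" "v \<notin> set us"
  shows "\<exists>(y, z) \<in> set (arcs_upto M (x # us) j). z < v \<and> v < y"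
  using assms
proof (induction us arbitrary: M x)
  case (Cons u us)
  show ?case
  proof (cases "u < v")
    case False
    with Cons.prems have "v < u" "k \<in> set us" "v \<notin> set us" by auto
    from Cons.IH[OF this(1) Cons.prems(2) this(2,3), of "max M x"] show ?thesis by auto
  qed (use Cons.prems in auto)
qed simp

lemma arcs_descent:
  assumes "v < x" "k < v" "k \<in> set us" "v \<notin> set us"
  shows "\<exists>(y, z) \<in> set (arcs M (x # us)). z < v \<and> v < y"
  using assms
proof (induction us arbitrary: M x)
  case (Cons u us)
  show ?case
  proof (cases "u < v")
    case False
    with Cons.prems have "v < u" "k \<in> set us" "v \<notin> set us" by auto
    from Cons.IH[OF this(1) Cons.prems(2) this(2,3), of "max M x"] show ?thesis by auto
  qed (use Cons.prems in auto)
qed simp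

text \<open>The letters must climb above \<open>v\<close>, at the latest with \<open>j\<close>. The
  arc into the first such letter ends there or at the running maximum, both above
  \<open>v\<close>.\<close>

lemma arcs_upto_ascent:
  assumes "x < v" "v < M" "v < j" "v \<notin> set us"
  shows "\<exists>(y, z) \<in> set (arcs_upto M (x # us) j). y < v \<and> v < z"
  using assms
proof (induction us arbitrary: M x)
  case (Cons u us)
  show ?case
  proof (cases "v < u")
    case False
    with Cons.prems have "u < v" "v < max M x" "v \<notin> set us" by auto
    from Cons.IH[OF this(1,2) Cons.prems(3) this(3)] show ?thesis by auto
  qed (use Cons.prems in auto)
qed auto

text \<open>If no later letter exceeds \<open>v\<close>, the last arc passes \<open>v\<close>, since
  it closes at the running maximum.\<close>

lemma arcs_ascent:
  assumes "x < v" "v < M" "v \<notin> set us"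
  shows "\<exists>(y, z) \<in> set (arcs M (x # us)). y < v \<and> v < z"
  using assms
proof (induction us arbitrary: M x)
  case (Cons u us)
  show ?case
  proof (cases "v < u")
    case False
    with Cons.prems have "u < v" "v < max M x" "v \<notin> set us" by auto
    from Cons.IH[OF this] show ?thesis by auto
  qed (use Cons.prems in auto)
qed auto

text \<open>An image above \<open>v\<close> requires a running maximum above \<open>v\<close>, but
  the scan starts with \<open>M \<le> v\<close>. So a letter above \<open>v\<close> precedes
  \<open>a\<close>, and between the two the word descends past \<open>v\<close>.\<close>

lemma arcs_upto_ascent_imp_descent:
  assumes "(a, b) \<in> set (arcs_upto M xs j)" "a < v" "v < b" "M \<le> v" "v \<notin> set xs"
  shows "\<exists>(y, z) \<in> set (arcs_upto M xs j). z < v \<and> v < y"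
  using assms
proof (induction xs arbitrary: M)
  case (Cons x xs)
  show ?case
  proof (cases "x < v")
    case True
    then have "next_val (max M x) (xs @ [j]) \<le> v"
      using Cons.prems by (auto simp: next_val_def split: list.split)
    with Cons.prems have "(a, b) \<in> set (arcs_upto (max M x) xs j)" by auto
    from Cons.IH[OF this] Cons.prems True show ?thesis by auto
  next
    case False
    with Cons.prems have "v < x" "a \<in> set xs"
      using fst_set_arcs_upto[of "max M x" xs j] by force+
    from arcs_upto_descent[OF this(1) \<open>a < v\<close> this(2)] Cons.prems show ?thesis by auto
  qed
qed simp

text \<open>After the descent the running maximum is at least \<open>l\<close>, hence above
  \<open>v\<close>, and the word still has to return to \<open>j\<close>.\<close>

lemma arcs_upto_descent_imp_ascent:
  assumes "(l, d) \<in> set (arcs_upto M xs j)" "d < v" "v < l" "v < j" "v \<notin> set xs"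
  shows "\<exists>(y, z) \<in> set (arcs_upto M xs j). y < v \<and> v < z"
  using assms
proof (induction xs arbitrary: M)
  case (Cons x xs)
  show ?case
  proof (cases "(l, d) \<in> set (arcs_upto (max M x) xs j)")
    case True
    from Cons.IH[OF this] Cons.prems show ?thesis by auto
  next
    case False
    with Cons.prems have "l = x" "d = next_val (max M x) (xs @ [j])" by auto
    with Cons.prems obtain u us where "xs = u # us" "u < v"
      by (cases xs) (auto simp: min_def split: if_splits)
    then show ?thesis
      using arcs_upto_ascent[of u v "max M x" j us] Cons.prems \<open>l = x\<close> by auto
  qed
qed simp

lemma arcs_descent_imp_ascent:
  assumes "(l, d) \<in> set (arcs M xs)" "d < v" "v < l" "v \<notin> set xs"
  shows "\<exists>(y, z) \<in> set (arcs M xs). y < v \<and> v < z"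
  using assms
proof (induction xs arbitrary: M)
  case (Cons x xs)
  show ?case
  proof (cases "(l, d) \<in> set (arcs (max M x) xs)")
    case True
    from Cons.IH[OF this] Cons.prems show ?thesis by auto
  next
    case False
    with Cons.prems have "l = x" "d = next_val (max M x) xs" by auto
    with Cons.prems obtain u us where "xs = u # us" "u < v"
      by (cases xs) (auto simp: min_def split: if_splits)
    then show ?thesis
      using arcs_ascent[of u v "max M x" us] Cons.prems \<open>l = x\<close> by auto
  qed
qed simp

subsection \<open>Deleting the smallest letter\<close>

text \<open>Subtraction on \<open>nat\<close> truncates, so only arcs with \<open>a < b\<close>
  contribute, as in the depth.\<close>

definition height :: "(nat \<times> nat) set \<Rightarrow> nat" where
  "height G = (\<Sum>(a, b)\<in>G. b - a)"

definition inverted :: "nat \<times> nat \<Rightarrow> nat \<times> nat \<Rightarrow> bool" where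
  "inverted p q \<longleftrightarrow> fst p < fst q \<and> snd q < snd p"

definition inversions :: "(nat \<times> nat) set \<Rightarrow> ((nat \<times> nat) \<times> (nat \<times> nat)) set" where
  "inversions G = {(p, q). p \<in> G \<and> q \<in> G \<and> inverted p q}"

lemma finite_inversions: "finite G \<Longrightarrow> finite (inversions G)"
  by (rule finite_subset[of _ "G \<times> G"]) (auto simp: inversions_def)

lemma card_inversions_insert:
  assumes "finite C" "p \<notin> C"
  shows "card (inversions (insert p C)) =
           card (inversions C) + card {q \<in> C. inverted q p} + card {q \<in> C. inverted p q}"
proof -
  let ?A = "(\<lambda>q. (q, p)) ` {q \<in> C. inverted q p}" and ?B = "Pair p ` {q \<in> C. inverted p q}"
  have "inversions (insert p C) = (inversions C \<union> ?A) \<union> ?B"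
    by (auto simp: inversions_def inverted_def)
  moreover have "card ((inversions C \<union> ?A) \<union> ?B) = card (inversions C \<union> ?A) + card ?B"
    using assms by (intro card_Un_disjoint) (auto simp: finite_inversions, auto simp: inversions_def)
  moreover have "card (inversions C \<union> ?A) = card (inversions C) + card ?A"
    using assms by (intro card_Un_disjoint) (auto simp: finite_inversions, auto simp: inversions_def)
  moreover have "card ?A = card {q \<in> C. inverted q p}" "card ?B = card {q \<in> C. inverted p q}"
    by (auto intro!: card_image inj_onI)
  ultimately show ?thesis by simp
qed

text \<open>\<open>C\<close> stands for the arcs that the deletion of \<open>t\<close> leaves alone.
  With \<open>(j, t)\<close> and \<open>(t, m)\<close> they form the graph of a permutation of
  \<open>{t..n}\<close>, with \<open>(j, m)\<close> that of one of \<open>{t<..n}\<close>.\<close>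

context
  fixes C :: "(nat \<times> nat) set" and t n j m :: nat
  assumes fin: "finite C"
    and inj: "inj_on fst C" "inj_on snd C"
    and img: "fst ` C = {t<..n} - {j}" "snd ` C = {t<..n} - {m}"
    and jm: "j \<in> {t<..n}" "m \<in> {t<..n}"
begin

lemma card_fst_less: "card {q \<in> C. fst q < j} = j - t - 1"
proof -
  have "fst ` {q \<in> C. fst q < j} = fst ` C \<inter> {..<j}" by auto
  also have "\<dots> = {t<..<j}" using jm unfolding img by auto
  finally show ?thesis
    using card_image[OF inj_on_subset[OF inj(1)], of "{q \<in> C. fst q < j}"] by auto
qed

lemma card_snd_less: "card {q \<in> C. snd q < m} = m - t - 1"
proof -
  have "snd ` {q \<in> C. snd q < m} = snd ` C \<inter> {..<m}" by auto
  also have "\<dots> = {t<..<m}" using jm unfolding img by auto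
  finally show ?thesis
    using card_image[OF inj_on_subset[OF inj(2)], of "{q \<in> C. snd q < m}"] by auto
qed

lemma C_bounds:
  assumes "q \<in> C"
  shows "t < fst q" "t < snd q" "fst q \<noteq> j" "snd q \<noteq> m"
proof -
  have "fst q \<in> {t<..n} - {j}" "snd q \<in> {t<..n} - {m}"
    using assms imageI[of q C fst] imageI[of q C snd] unfolding img by auto
  then show "t < fst q" "t < snd q" "fst q \<noteq> j" "snd q \<noteq> m" by auto
qed

text \<open>There are \<open>j - t - 1\<close> arcs starting below \<open>j\<close> and
  \<open>m - t - 1\<close> ending below \<open>m\<close>. Removing the arcs that do both leaves the
  counts \<open>\<alpha>\<close> and \<open>\<beta>\<close>.\<close>

lemma card_inverted_balance:
  "card {q \<in> C. inverted q (j, m)} + m = card {q \<in> C. inverted (j, m) q} + j"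
proof -
  let ?g = "{q \<in> C. fst q < j \<and> snd q < m}"
  have 1: "{q \<in> C. fst q < j} = {q \<in> C. inverted q (j, m)} \<union> ?g"
    using C_bounds by (auto simp: inverted_def) (metis linorder_neqE_nat)
  have 2: "{q \<in> C. snd q < m} = {q \<in> C. inverted (j, m) q} \<union> ?g"
    using C_bounds by (auto simp: inverted_def) (metis linorder_neqE_nat)
  have "card {q \<in> C. fst q < j} = card {q \<in> C. inverted q (j, m)} + card ?g"
    unfolding 1 using fin by (intro card_Un_disjoint) (auto simp: inverted_def)
  moreover have "card {q \<in> C. snd q < m} = card {q \<in> C. inverted (j, m) q} + card ?g"
    unfolding 2 using fin by (intro card_Un_disjoint) (auto simp: inverted_def)
  ultimately show ?thesis using card_fst_less card_snd_less jm by auto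
qed

text \<open>Each side exceeds the height of \<open>C\<close> by \<open>m\<close>: the arc
  \<open>(j, t)\<close> goes down and counts 0, \<open>(t, m)\<close> counts \<open>m - t\<close>,
  and truncated \<open>m - j\<close> plus \<open>min j m\<close> is \<open>m\<close>.\<close>

lemma height_delete:
  "height (insert (j, t) (insert (t, m) C)) + t = height (insert (j, m) C) + min j m"
proof -
  have "(j, t) \<notin> C" "(t, m) \<notin> C" "(j, m) \<notin> C" "(j, t) \<noteq> (t, m)"
    using C_bounds jm by fastforce+
  then show ?thesis using fin jm by (auto simp: height_def)
qed

text \<open>Against \<open>C\<close>, the arc \<open>(j, m)\<close> has
  \<open>\<alpha> + \<beta>\<close> inversions and \<open>(t, m)\<close> has
  \<open>m - t - 1\<close>. The arc \<open>(j, t)\<close> has \<open>j - t\<close>: those with the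
  arcs of \<open>C\<close> starting below \<open>j\<close>, and one with
  \<open>(t, m)\<close>.\<close>

lemma card_inversions_delete:
  "card (inversions (insert (j, t) (insert (t, m) C)))
     + card {q \<in> C. inverted q (j, m)} + card {q \<in> C. inverted (j, m) q} + 2 * t + 1
   = card (inversions (insert (j, m) C)) + j + m"
proof -
  have *: "(j, t) \<notin> insert (t, m) C" "(t, m) \<notin> C" "(j, m) \<notin> C"
    using C_bounds jm by fastforce+
  have "{q \<in> insert (t, m) C. inverted q (j, t)} = insert (t, m) {q \<in> C. fst q < j}"
    using C_bounds jm by (auto simp: inverted_def)
  then have a: "card {q \<in> insert (t, m) C. inverted q (j, t)} = j - t"
    using card_fst_less fin * jm by (simp add: Suc_diff_Suc)
  have "{q \<in> insert (t, m) C. inverted (j, t) q} = {}"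
    using C_bounds jm by (force simp: inverted_def)
  then have b: "card {q \<in> insert (t, m) C. inverted (j, t) q} = 0" by (simp only: card.empty)
  have "{q \<in> C. inverted q (t, m)} = {}"
    using C_bounds by (force simp: inverted_def)
  then have c: "card {q \<in> C. inverted q (t, m)} = 0" by (simp only: card.empty)
  have "{q \<in> C. inverted (t, m) q} = {q \<in> C. snd q < m}"
    using C_bounds by (auto simp: inverted_def)
  then have d: "card {q \<in> C. inverted (t, m) q} = m - t - 1"
    using card_snd_less by simp
  show ?thesis
    using card_inversions_insert[of "insert (t, m) C" "(j, t)"] card_inversions_insert[of C "(t, m)"]
      card_inversions_insert[of C "(j, m)"] * fin a b c d jm by simp
qed

end

section \<open>The deficit and its change under deletion\<close>

lemma le_fold_max: "x \<in> set xs \<Longrightarrow> x \<le> fold max xs (M::nat)"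
  by (metis List.finite_set Max.set_eq_fold Max_ge list.set_intros(2) list.simps(15) insertCI)

lemma lr_maxima_delete:
  "t < j \<Longrightarrow> lr_maxima M (xs @ j # t # ys) = lr_maxima M (xs @ j # ys)"
  by (induction xs arbitrary: M) auto

text \<open>
  The number of left-to-right maxima is the number of cycles, so this is
  \<open>2 dp - \<ell>\<^sub>S - \<ell>\<^sub>T\<close>.
\<close>

definition deficit :: "nat list \<Rightarrow> int" where
  "deficit w = 2 * int (height (set (arcs 0 w))) - int (card (inversions (set (arcs 0 w))))
               - (int (length w) - int (lr_maxima 0 w))"

text \<open>The case where a letter \<open>j\<close> stands just before the smallest letter
  \<open>t\<close>. As \<open>t < j\<close>, the running maximum \<open>M\<close> at
  \<open>j\<close> survives \<open>t\<close>; hence \<open>m\<close> is the image of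
  \<open>t\<close>, and of \<open>j\<close> after the deletion, while \<open>P\<close> and
  \<open>R\<close> are the same for both words.\<close>

context
  fixes xs ys :: "nat list" and j t n M m :: nat and P R :: "(nat \<times> nat) list"
    and C :: "(nat \<times> nat) set"
  assumes dist: "distinct (xs @ j # t # ys)" and letters: "set (xs @ j # t # ys) = {t..n}"
  defines "P \<equiv> arcs_upto 0 xs j" and "M \<equiv> max (fold max xs 0) j"
    and "m \<equiv> next_val M ys" and "R \<equiv> arcs M ys" and "C \<equiv> set P \<union> set R"
begin

lemma t_less: "t < j" "x \<in> set xs \<Longrightarrow> t < x" "x \<in> set ys \<Longrightarrow> t < x"
proof -
  have "t < x" if "x \<in> set (xs @ j # ys)" for x
    using that letters dist by (cases "x = t") (auto dest!: equalityD1)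
  then show "t < j" "x \<in> set xs \<Longrightarrow> t < x" "x \<in> set ys \<Longrightarrow> t < x" by auto
qed

lemma j_le_M: "j \<le> M" by (simp add: M_def)

lemma t_less_m: "t < m"
  using t_less j_le_M by (cases ys) (auto simp: m_def)

lemma arcs_with: "arcs 0 (xs @ j # t # ys) = P @ (j, t) # (t, m) # R"
proof -
  have "max M t = M" using t_less j_le_M by simp
  then show ?thesis using t_less
    by (simp add: arcs_append P_def R_def m_def M_def max_def min_def split: if_splits)
qed

lemma arcs_without: "arcs 0 (xs @ j # ys) = P @ (j, m) # R"
  by (simp add: arcs_append P_def R_def m_def M_def max.commute)

lemma fst_P: "fst ` set P = set xs" and fst_R: "fst ` set R = set ys"
  by (simp_all add: P_def R_def fst_set_arcs_upto fst_set_arcs)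

lemma snd_arcs_with:
  "distinct (map snd (P @ (j, t) # (t, m) # R))"
  "set (map snd (P @ (j, t) # (t, m) # R)) = {t..n}"
proof -
  have "mset (map snd (P @ (j, t) # (t, m) # R)) = mset (xs @ j # t # ys)"
    using mset_snd_arcs[of "xs @ j # t # ys"] by (simp only: arcs_with)
  then show "distinct (map snd (P @ (j, t) # (t, m) # R))"
    "set (map snd (P @ (j, t) # (t, m) # R)) = {t..n}"
    using dist letters mset_eq_imp_distinct_iff mset_eq_setD by metis+
qed

lemma C_facts:
  "inj_on fst C" "inj_on snd C" "fst ` C = {t<..n} - {j}" "snd ` C = {t<..n} - {m}"
  "j \<in> {t<..n}" "m \<in> {t<..n}"
proof -
  have "distinct (map fst (P @ R))"
    using dist by (simp add: P_def R_def)
  then have "inj_on fst (set (P @ R))" by (simp only: distinct_map)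
  then show "inj_on fst C" by (simp add: C_def)
  have "distinct (map snd (P @ R))"
    using snd_arcs_with(1) by auto
  then have "inj_on snd (set (P @ R))" by (simp only: distinct_map)
  then show "inj_on snd C" by (simp add: C_def)
  have "fst ` C = set xs \<union> set ys" by (simp add: C_def image_Un fst_P fst_R)
  also have "\<dots> = set (xs @ j # t # ys) - {t, j}" using dist by auto
  also have "\<dots> = {t<..n} - {j}" unfolding letters by auto
  finally show "fst ` C = {t<..n} - {j}" .
  have "snd ` C = set (map snd (P @ (j, t) # (t, m) # R)) - {t, m}"
    using snd_arcs_with(1) by (auto simp: C_def image_Un)
  also have "\<dots> = {t<..n} - {m}" unfolding snd_arcs_with(2) by auto
  finally show "snd ` C = {t<..n} - {m}" .
  have "j \<in> {t..n}" using letters by auto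
  then show "j \<in> {t<..n}" using t_less by auto
  have "m \<in> {t..n}" using snd_arcs_with(2) by auto
  then show "m \<in> {t<..n}" using t_less_m by auto
qed

lemma finite_C: "finite C" by (simp add: C_def)

lemma C_I: "p \<in> set P \<Longrightarrow> p \<in> C" "p \<in> set R \<Longrightarrow> p \<in> C" by (simp_all add: C_def)

lemma C_pair:
  assumes "(a, b) \<in> C"
  shows "t < a" "t < b" "a \<noteq> j" "b \<noteq> m"
  using C_facts(3,4) imageI[OF assms, of fst] imageI[OF assms, of snd] by auto

text \<open>The terms in \<open>t\<close> and the constants cancel, leaving a change of
  \<open>\<alpha> + \<beta> + 2 min j m - j - m\<close>, that is
  \<open>\<alpha> + \<beta> - |j - m|\<close>. With \<open>\<alpha> - \<beta> = j - m\<close> this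
  is twice the minimum.\<close>

lemma deficit_delete:
  "deficit (xs @ j # t # ys) = deficit (xs @ j # ys) +
     2 * int (min (card {q \<in> C. inverted q (j, m)}) (card {q \<in> C. inverted (j, m) q}))"
proof -
  have *: "set (P @ (j, t) # (t, m) # R) = insert (j, t) (insert (t, m) C)"
    "set (P @ (j, m) # R) = insert (j, m) C" by (auto simp: C_def)
  show ?thesis
    unfolding deficit_def arcs_with arcs_without *
    using height_delete[OF finite_C C_facts] card_inversions_delete[OF finite_C C_facts]
      card_inverted_balance[OF finite_C C_facts] lr_maxima_delete[OF t_less(1), of 0 xs ys]
    by (cases "j \<le> m"; simp add: min_def; linarith)
qed

text \<open>Since \<open>j \<le> M\<close>, an image \<open>m < j\<close> cannot be the running
  maximum, so it is the next letter.\<close>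

lemma m_less_j:
  assumes "m < j"
  obtains zs where "ys = m # zs" "m \<notin> set xs" "M > m"
  using assms j_le_M dist by (cases ys) (auto simp: m_def min_def split: if_splits)

text \<open>From \<open>j \<le> m\<close> it follows that \<open>ys\<close> begins above
  \<open>j\<close>; on the way down to \<open>k\<close> the word passes level
  \<open>j\<close>.\<close>

lemma R_descent:
  assumes "j \<le> m" "k < j" "k \<in> set ys"
  shows "\<exists>(c, d) \<in> set R. d < j \<and> j < c"
proof -
  obtain z zs where ys: "ys = z # zs" using assms by (cases ys) auto
  then have "j < z" "j \<notin> set zs" "k \<in> set zs" using assms dist by (auto simp: m_def)
  with arcs_descent[of j z k zs M] \<open>k < j\<close> show ?thesis by (auto simp: R_def ys)
qed

text \<open>
  The left-hand side collects the wrong crossings of \<open>(t, m)\<close> and \<open>(j, t)\<close> with other arcs,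
  the right-hand side those of \<open>(j, m)\<close> together with a positive drop of the deficit.
\<close>

lemma crossing_transfer:
  "(\<exists>(a, b) \<in> set P. a < m \<and> m < b) \<or> (\<exists>(c, d) \<in> set R. d < j \<and> j < c) \<longleftrightarrow>
   (\<exists>p \<in> set P. cross p (j, m)) \<or> (\<exists>r \<in> set R. cross (j, m) r) \<or>
   (\<exists>q \<in> C. inverted q (j, m)) \<and> (\<exists>q \<in> C. inverted (j, m) q)"
  (is "?A1 \<or> ?A2 \<longleftrightarrow> ?B1 \<or> ?B2 \<or> ?K \<and> ?L")
proof -
  have balance: "card {q \<in> C. inverted q (j, m)} + m = card {q \<in> C. inverted (j, m) q} + j"
    by (rule card_inverted_balance[OF finite_C C_facts])
  have pos: "0 < card {q \<in> C. Q q} \<longleftrightarrow> (\<exists>q \<in> C. Q q)" for Q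
    using finite_C by (auto simp: card_gt_0_iff)
  \<comment> \<open>By the balance, \<open>\<beta> \<ge> \<alpha>\<close> if
    \<open>j \<le> m\<close> and \<open>\<alpha> \<ge> \<beta>\<close> if \<open>m \<le> j\<close>;
    an arc of the rarer kind thus supplies one of the other kind.\<close>
  have KL: "?L" if "?K" "j \<le> m"
    using balance that pos[of "\<lambda>q. inverted q (j, m)"] pos[of "inverted (j, m)"] by linarith
  have LK: "?K" if "?L" "m \<le> j"
    using balance that pos[of "\<lambda>q. inverted q (j, m)"] pos[of "inverted (j, m)"] by linarith
  \<comment> \<open>For \<open>m < j\<close> the level \<open>m\<close> is missing from
    \<open>xs\<close>, and the prefix has to come back above it to reach \<open>j\<close>.\<close>
  have P_asc: ?A1 if "(l, d) \<in> set P" "d < m" "m < l" "m < j" for l d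
    using arcs_upto_descent_imp_ascent[of l d 0 xs j m] that m_less_j
    by (auto simp: P_def)
  show ?thesis
  proof
    assume "?A1 \<or> ?A2"
    then show "?B1 \<or> ?B2 \<or> ?K \<and> ?L"
    proof
      assume ?A1
      then obtain a b where ab: "(a, b) \<in> set P" "a < m" "m < b" by auto
      consider "j < a" | "a < j" "j \<le> m" | "a < j" "m < j"
        using C_pair ab by (metis C_I linorder_neqE_nat not_le)
      then show ?thesis
      proof cases
        case 1
        then have "cross (a, b) (j, m)" using ab by (simp add: cross_def)
        then show ?thesis using ab by blast
      next
        case 2
        then have ?K using ab by (auto simp: inverted_def C_I intro!: bexI[of _ "(a, b)"])
        then show ?thesis using KL 2 by blast
      next
        case 3
        then have K: ?K using ab by (auto simp: inverted_def C_I intro!: bexI[of _ "(a, b)"])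
        \<comment> \<open>The prefix starts at running maximum 0, so its ascent past
          \<open>m\<close> forces a descent past \<open>m\<close>. If that starts below
          \<open>j\<close>, it makes a wrong crossing with \<open>(j, m)\<close>; otherwise it is an
          arc for \<open>?L\<close>.\<close>
        obtain y z where yz: "(y, z) \<in> set P" "z < m" "m < y"
          using arcs_upto_ascent_imp_descent[of a b 0 xs j m] ab m_less_j[OF 3(2)]
          by (auto simp: P_def)
        show ?thesis
        proof (cases "y < j")
          case True
          then have "cross (y, z) (j, m)" using yz by (simp add: cross_def)
          then show ?thesis using yz by blast
        next
          case False
          then have "j < y" using C_pair yz by (metis C_I linorder_neqE_nat)
          then have ?L using yz by (auto simp: inverted_def C_I intro!: bexI[of _ "(y, z)"])
          then show ?thesis using K by blast
        qed
      qed
    next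
      assume ?A2
      then obtain c d where cd: "(c, d) \<in> set R" "d < j" "j < c" by auto
      have "d \<noteq> m" using C_pair C_I cd by blast
      then consider "m < d" | "d < m" "m \<le> j" | "d < m" "j < m" by linarith
      then show ?thesis
      proof cases
        case 1
        then have "cross (j, m) (c, d)" using cd by (simp add: cross_def)
        then show ?thesis using cd by blast
      next
        case 2
        then have ?L using cd by (auto simp: inverted_def C_I intro!: bexI[of _ "(c, d)"])
        then show ?thesis using LK 2 by blast
      next
        case 3
        then have L: ?L using cd by (auto simp: inverted_def C_I intro!: bexI[of _ "(c, d)"])
        \<comment> \<open>Mirror image: a descent past \<open>j\<close> in the suffix forces an
          ascent past \<open>j\<close>, whose end \<open>y\<close> is compared with
          \<open>m\<close>.\<close>
        obtain z y where zy: "(z, y) \<in> set R" "z < j" "j < y"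
          using arcs_descent_imp_ascent[of c d M ys j] cd dist by (auto simp: R_def)
        show ?thesis
        proof (cases "y < m")
          case True
          then have "cross (j, m) (z, y)" using zy by (simp add: cross_def)
          then show ?thesis using zy by blast
        next
          case False
          then have "m < y" using C_pair zy by (metis C_I linorder_neqE_nat)
          then have ?K using zy by (auto simp: inverted_def C_I intro!: bexI[of _ "(z, y)"])
          then show ?thesis using L by blast
        qed
      qed
    qed
  next
    assume "?B1 \<or> ?B2 \<or> ?K \<and> ?L"
    then consider ?B1 | ?B2 | "?K \<and> ?L" by blast
    then show "?A1 \<or> ?A2"
    proof cases
      case 1
      then obtain a b where "(a, b) \<in> set P" "cross (a, b) (j, m)" by auto
      \<comment> \<open>The crossing arc either ascends past \<open>m\<close> itself or descends
        past \<open>m < j\<close>, and then \<open>P_asc\<close> applies.\<close>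
      then show ?thesis using P_asc[of a b] by (auto simp: cross_def)
    next
      case 2
      then obtain c d where cd: "(c, d) \<in> set R" "cross (j, m) (c, d)" by auto
      then have "c \<in> set ys" using fst_R by force
      with cd R_descent[of c] show ?thesis by (auto simp: cross_def)
    next
      case 3
      \<comment> \<open>For \<open>m < j\<close> the arc \<open>(l, v)\<close> descends past both
        levels, for \<open>j \<le> m\<close> the arc \<open>(k, u)\<close> ascends past both.
        Depending on whether it lies in \<open>P\<close> or \<open>R\<close>, it is itself the
        required arc or forces an opposite passage.\<close>
      then obtain k u l v where kl: "(k, u) \<in> C" "k < j" "m < u" "(l, v) \<in> C" "j < l" "v < m"
        by (auto simp: inverted_def)
      show ?thesis
      proof (cases "m < j")
        case True
        then have "v < j" using kl by simp
        then have ?A2 if "(l, v) \<in> set R" using kl that by blast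
        then show ?thesis using kl P_asc[of l v] True by (auto simp: C_def)
      next
        case False
        show ?thesis
        proof (cases "(k, u) \<in> set P")
          case True
          moreover have "k < m" using kl \<open>\<not> m < j\<close> by simp
          ultimately show ?thesis using kl by blast
        next
          case False
          then have "k \<in> set ys" using kl fst_R by (force simp: C_def)
          with R_descent kl \<open>\<not> m < j\<close> show ?thesis by auto
        qed
      qed
    qed
  qed
qed

lemma uncrossed_delete:
  "uncrossed (arcs 0 (xs @ j # t # ys)) \<longleftrightarrow> uncrossed (arcs 0 (xs @ j # ys)) \<and>
     min (card {q \<in> C. inverted q (j, m)}) (card {q \<in> C. inverted (j, m) q}) = 0"
proof -
  \<comment> \<open>No letter or image lies below \<open>t\<close>, so for each of
    \<open>(j, t)\<close> and \<open>(t, m)\<close> only one side of the word and one disjunct of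
    \<open>cross\<close> remain possible.\<close>
  have P: "cross p (j, t) = False" "cross p (t, m) \<longleftrightarrow> fst p < m \<and> m < snd p" if "p \<in> set P" for p
    using C_pair[of "fst p" "snd p"] C_I that by (auto simp: cross_def)
  have R: "cross (t, m) r = False" "cross (j, t) r \<longleftrightarrow> snd r < j \<and> j < fst r" if "r \<in> set R" for r
    using C_pair[of "fst r" "snd r"] C_I that t_less by (auto simp: cross_def)
  have 0: "\<not> cross (j, t) (t, m)" by (simp add: cross_def)
  have min_eq_0: "min x y = 0 \<longleftrightarrow> x = 0 \<or> y = 0" for x y :: nat by (auto simp: min_def)
  have "min (card {q \<in> C. inverted q (j, m)}) (card {q \<in> C. inverted (j, m) q}) = 0 \<longleftrightarrow>
        \<not> ((\<exists>q \<in> C. inverted q (j, m)) \<and> (\<exists>q \<in> C. inverted (j, m) q))"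
    using finite_C by (auto simp: min_eq_0 card_eq_0_iff)
  moreover have "uncrossed (arcs 0 (xs @ j # t # ys)) \<longleftrightarrow> uncrossed P \<and> uncrossed R \<and>
     (\<forall>p \<in> set P. \<forall>r \<in> set R. \<not> cross p r) \<and>
     \<not> ((\<exists>(a, b) \<in> set P. a < m \<and> m < b) \<or> (\<exists>(c, d) \<in> set R. d < j \<and> j < c))"
    unfolding arcs_with by (auto simp: sorted_wrt_append P R 0)
  moreover have "uncrossed (arcs 0 (xs @ j # ys)) \<longleftrightarrow> uncrossed P \<and> uncrossed R \<and>
     (\<forall>p \<in> set P. \<forall>r \<in> set R. \<not> cross p r) \<and>
     \<not> ((\<exists>p \<in> set P. cross p (j, m)) \<or> (\<exists>r \<in> set R. cross (j, m) r))"
    unfolding arcs_without by (auto simp: sorted_wrt_append)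
  ultimately show ?thesis using crossing_transfer by blast
qed

end

section \<open>Induction on the number of letters\<close>

lemma arcs_Cons_min:
  assumes "\<forall>y \<in> set ys. t < y"
  shows "arcs 0 (t # ys) = (t, t) # arcs 0 ys" "lr_maxima 0 (t # ys) = of_bool (0 < t) + lr_maxima 0 ys"
  using assms by (cases ys; auto simp: max_def)+

text \<open>Nonnegativity is carried along because the deficit is a smaller deficit plus
  \<open>2 min \<alpha> \<beta>\<close>, and the sum vanishes exactly when both parts do. The bound
  \<open>t\<close> varies, as deleting the smallest letter leaves \<open>{Suc t..n}\<close>.\<close>

lemma deficit_eq_0_iff:
  assumes "distinct w" "set w = {t..n}" "0 < t"
  shows "0 \<le> deficit w \<and> (deficit w = 0 \<longleftrightarrow> uncrossed (arcs 0 w))"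
  using assms
proof (induction "length w" arbitrary: w t rule: less_induct)
  case less
  show ?case
  proof (cases "w = []")
    case True
    then show ?thesis by (simp add: deficit_def height_def inversions_def)
  next
    case False
    then have "{t..n} \<noteq> {}" using less.prems(2) by (metis set_empty)
    then have "t \<in> set w" using less.prems(2) by simp
    then obtain us ys where w: "w = us @ t # ys" by (auto simp: in_set_conv_decomp)
    have "distinct (us @ ys)" "set (us @ ys) = set w - {t}"
      using less.prems unfolding w by auto
    moreover have "{t..n} - {t} = {Suc t..n}" by auto
    ultimately have rest: "set (us @ ys) = {Suc t..n}" "distinct (us @ ys)"
      using less.prems(2) by simp_all
    have IH: "0 \<le> deficit (us @ ys) \<and> (deficit (us @ ys) = 0 \<longleftrightarrow> uncrossed (arcs 0 (us @ ys)))"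
      using less.hyps[of "us @ ys" "Suc t"] rest w by simp
    show ?thesis
    proof (cases us rule: rev_cases)
      case Nil
      \<comment> \<open>A leading \<open>t\<close> is a fixed point below all other letters: it adds
        neither height nor inversions, and its share of the length is offset by one further
        left-to-right maximum, as \<open>0 < t\<close>.\<close>
      have gt: "\<forall>y \<in> set ys. t < y" using rest Nil by auto
      let ?G = "set (arcs 0 ys)"
      have gt': "t < a \<and> t < b" if "(a, b) \<in> ?G" for a b
      proof -
        have "a \<in> set ys" using that fst_set_arcs[of 0 ys] by force
        moreover have "b \<in> set ys"
          using that mset_eq_setD[OF mset_snd_arcs[of ys]] by force
        ultimately show ?thesis using gt by auto
      qed
      then have n: "(t, t) \<notin> ?G" by blast
      have "{q \<in> ?G. inverted q (t, t)} = {}" "{q \<in> ?G. inverted (t, t) q} = {}"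
        using gt' by (fastforce simp: inverted_def)+
      then have "card (inversions (insert (t, t) ?G)) = card (inversions ?G)"
        using card_inversions_insert[of ?G "(t, t)"] n by simp
      moreover have "height (insert (t, t) ?G) = height ?G"
        using n by (simp add: height_def)
      ultimately have "deficit w = deficit ys"
        using less.prems(3)
        unfolding w Nil append_Nil deficit_def arcs_Cons_min[OF gt] list.set by simp
      moreover have "uncrossed (arcs 0 w) \<longleftrightarrow> uncrossed (arcs 0 ys)"
        unfolding w Nil append_Nil arcs_Cons_min[OF gt] by (simp add: cross_def)
      ultimately show ?thesis using IH Nil by simp
    next
      case (snoc xs j)
      then have "w = xs @ j # t # ys" using w by simp
      then have "distinct (xs @ j # t # ys)" "set (xs @ j # t # ys) = {t..n}"
        using less.prems(1,2) by simp_all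
      note delete = deficit_delete[OF this] uncrossed_delete[OF this]
      have step: "0 \<le> d \<and> (d = 0 \<longleftrightarrow> u)"
        if "d = d' + 2 * int c" "u \<longleftrightarrow> u' \<and> c = 0" "0 \<le> d' \<and> (d' = 0 \<longleftrightarrow> u')" for d d' c u u'
        using that by auto
      from IH have "0 \<le> deficit (xs @ j # ys) \<and>
          (deficit (xs @ j # ys) = 0 \<longleftrightarrow> uncrossed (arcs 0 (xs @ j # ys)))"
        by (simp only: snoc append_assoc append_Cons append_Nil)
      from step[OF delete this] show ?thesis
        by (simp only: w snoc append_assoc append_Cons append_Nil)
    qed
  qed
qed

subsection \<open>The word of the fundamental bijection\<close>

text \<open>The block stays below \<open>m\<close>, which therefore remains the running maximum;
  what follows opens above \<open>m\<close>, so the last arc returns to \<open>m\<close>.\<close>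

lemma arcs_below_max:
  assumes "x \<le> m" "\<forall>y \<in> set blk. y < m" "rest = [] \<or> m < hd rest"
  shows "arcs m (x # blk @ rest) = zip (x # blk) (blk @ [m]) @ arcs m rest"
  using assms
proof (induction blk arbitrary: x)
  case Nil
  then show ?case by (cases rest) auto
next
  case (Cons b blk)
  then have "arcs m (b # blk @ rest) = zip (b # blk) (blk @ [m]) @ arcs m rest" by simp
  then show ?case using Cons.prems by (simp add: max_def)
qed

lemma lr_maxima_below_max:
  "\<forall>y \<in> set blk. y < m \<Longrightarrow> lr_maxima m (blk @ rest) = lr_maxima m rest"
  by (induction blk) (auto simp: max_def)

lemma rotate1_support:
  assumes "permutation p"
  shows "rotate1 (support p a) = map p (support p a)"
proof -
  let ?g = "\<lambda>i. (p ^^ i) a"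
  obtain k where k: "least_power p a = Suc k"
    using least_power_of_permutation(2)[OF assms] gr0_implies_Suc by blast
  have "map p (support p a) = map ?g (map Suc [0..<Suc k])" by (simp add: k)
  also have "\<dots> = map ?g [1..<Suc k] @ [?g (least_power p a)]"
    by (simp only: map_Suc_upt k) simp
  also have "\<dots> = rotate1 (support p a)"
    using least_power_of_permutation(1)[OF assms, of a] by (simp add: k upt_conv_Cons del: upt_Suc)
  finally show ?thesis by simp
qed

lemma support_Cons:
  assumes "permutation p"
  obtains blk where "support p a = a # blk" "blk @ [a] = map p (support p a)" "a \<notin> set blk"
proof -
  obtain k where k: "least_power p a = Suc k"
    using least_power_of_permutation(2)[OF assms] gr0_implies_Suc by blast
  define blk where "blk = map (\<lambda>i. (p ^^ i) a) [1..<Suc k]"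
  have s: "support p a = a # blk"
    by (simp add: k blk_def upt_conv_Cons del: upt_Suc)
  have "blk @ [a] = map p (support p a)"
    using rotate1_support[OF assms, of a] unfolding s by simp
  moreover have "a \<notin> set blk"
    using cycle_of_permutation[OF assms, of a] unfolding s by simp
  ultimately show ?thesis by (rule that[OF s])
qed

text \<open>Each block starts above everything before it, and nothing in it exceeds its first
  letter. So it yields exactly one left-to-right maximum and closes on itself, its arcs following
  \<open>p\<close>.\<close>

lemma arcs_concat_cycles:
  assumes "sorted_wrt (<) ms" "\<forall>m \<in> set ms. M < m"
    and "\<And>m. m \<in> set ms \<Longrightarrow>
      \<exists>blk. c m = m # blk \<and> blk @ [m] = map p (c m) \<and> (\<forall>y \<in> set blk. y < m)"
  shows "arcs M (concat (map c ms)) = map (\<lambda>x. (x, p x)) (concat (map c ms))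
       \<and> lr_maxima M (concat (map c ms)) = length ms"
  using assms
proof (induction ms arbitrary: M)
  case (Cons m ms)
  let ?rest = "concat (map c ms)"
  obtain blk where blk: "c m = m # blk" "blk @ [m] = map p (c m)" "\<forall>y \<in> set blk. y < m"
    using Cons.prems(3)[of m] by auto
  have IH: "arcs m ?rest = map (\<lambda>x. (x, p x)) ?rest" "lr_maxima m ?rest = length ms"
    using Cons.IH[of m] Cons.prems by simp_all
  have rest: "?rest = [] \<or> m < hd ?rest"
  proof (cases ms)
    case (Cons m' ms')
    obtain blk' where "c m' = m' # blk'" using Cons.prems(3)[of m'] Cons by auto
    with \<open>sorted_wrt (<) (m # ms)\<close> show ?thesis by (simp add: Cons)
  qed simp
  have M: "M < m" using Cons.prems(2) by simp
  then have max: "max M m = m" "max m m = m" by simp_all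
  have "arcs M (c m @ ?rest) = arcs m (m # blk @ ?rest)"
    unfolding blk(1) append_Cons arcs.simps max ..
  also have "\<dots> = zip (c m) (map p (c m)) @ map (\<lambda>x. (x, p x)) ?rest"
    using arcs_below_max[OF order_refl blk(3) rest] unfolding IH blk(1)[symmetric] blk(2) .
  finally have "arcs M (c m @ ?rest) = map (\<lambda>x. (x, p x)) (c m @ ?rest)"
    by (simp add: zip_map2 zip_same_conv_map)
  moreover have "lr_maxima M (c m @ ?rest) = Suc (length ms)"
    using lr_maxima_below_max[OF blk(3), of ?rest] M
    unfolding blk(1) append_Cons lr_maxima.simps max IH by simp
  ultimately show ?case by simp
qed simp

lemma distinct_concat_map:
  assumes "distinct ms" "\<And>m. m \<in> set ms \<Longrightarrow> distinct (c m)"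
    and "\<And>a b. a \<in> set ms \<Longrightarrow> b \<in> set ms \<Longrightarrow> a \<noteq> b \<Longrightarrow> set (c a) \<inter> set (c b) = {}"
  shows "distinct (concat (map c ms))"
  using assms
proof (induction ms)
  case (Cons m ms)
  have "distinct (concat (map c ms))" using Cons by simp
  moreover have "set (c m) \<inter> (\<Union>a \<in> set ms. set (c a)) = {}"
    using Cons.prems(1,3) by fastforce
  ultimately show ?case using Cons.prems(2) by simp
qed simp

section \<open>Cycles and arcs of a permutation\<close>

context
  fixes n :: nat and \<sigma> :: "nat \<Rightarrow> nat"
  assumes perm: "\<sigma> permutes {1..n}"
begin

lemma permutation_\<sigma>: "permutation \<sigma>"
  using perm permutation_permutes by blast

lemma set_support: "set (support \<sigma> a) = orbit \<sigma> a"
  using support_set[OF permutation_\<sigma>, of a] orbit_altdef_permutation[OF permutation_\<sigma>, of a]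
  by auto

lemma Max_orbit:
  assumes "i \<in> {1..n}"
  shows "Max (orbit \<sigma> i) \<in> orbit \<sigma> i" "orbit \<sigma> (Max (orbit \<sigma> i)) = orbit \<sigma> i"
    "orbit \<sigma> i \<subseteq> {1..n}" "x \<in> orbit \<sigma> i \<Longrightarrow> x \<le> Max (orbit \<sigma> i)"
proof -
  have i: "i \<in> orbit \<sigma> i" by (rule permutation_self_in_orbit[OF permutation_\<sigma>])
  then have f: "finite (orbit \<sigma> i)" by (rule finite_orbit)
  then show 1: "Max (orbit \<sigma> i) \<in> orbit \<sigma> i" using i by (intro Max_in) auto
  have "cyclic_on \<sigma> (orbit \<sigma> i)"
    using i by (auto simp: cyclic_on_def)
  with 1 show "orbit \<sigma> (Max (orbit \<sigma> i)) = orbit \<sigma> i"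
    by (simp add: cyclic_on_alldef)
  show "orbit \<sigma> i \<subseteq> {1..n}" by (rule permutes_orbit_subset[OF perm assms])
  show "x \<in> orbit \<sigma> i \<Longrightarrow> x \<le> Max (orbit \<sigma> i)" using f by (rule Max_ge)
qed

lemma orbit_cycle_max: "m \<in> Max ` cycle_sets n \<sigma> \<Longrightarrow> Max (orbit \<sigma> m) = m \<and> m \<in> {1..n}"
  using Max_orbit by (fastforce simp: cycle_sets_def)

lemma set_cycle_maxima:
  "set (sorted_list_of_set (Max ` cycle_sets n \<sigma>)) = Max ` cycle_sets n \<sigma>"
  by (simp add: cycle_sets_def)

text \<open>A cycle is the orbit of its maximum, so distinct cycles have distinct maxima.\<close>

lemma length_cycle_maxima:
  "length (sorted_list_of_set (Max ` cycle_sets n \<sigma>)) = card (cycle_sets n \<sigma>)"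
proof -
  have "inj_on Max (cycle_sets n \<sigma>)"
  proof (rule inj_onI)
    fix A B assume "A \<in> cycle_sets n \<sigma>" "B \<in> cycle_sets n \<sigma>" "Max A = Max B"
    moreover obtain i j where "A = orbit \<sigma> i" "i \<in> {1..n}" "B = orbit \<sigma> j" "j \<in> {1..n}"
      using calculation by (auto simp: cycle_sets_def)
    ultimately show "A = B" using Max_orbit(2) by metis
  qed
  then show ?thesis by (simp add: card_image)
qed

lemma arcs_fundamental_word:
  "arcs 0 (fundamental_word n \<sigma>) = map (\<lambda>x. (x, \<sigma> x)) (fundamental_word n \<sigma>)"
  "lr_maxima 0 (fundamental_word n \<sigma>) = card (cycle_sets n \<sigma>)"
proof -
  let ?ms = "sorted_list_of_set (Max ` cycle_sets n \<sigma>)"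
  have "\<exists>blk. support \<sigma> m = m # blk \<and> blk @ [m] = map \<sigma> (support \<sigma> m) \<and> (\<forall>y \<in> set blk. y < m)"
    if "m \<in> set ?ms" for m
  proof -
    obtain blk where blk: "support \<sigma> m = m # blk" "blk @ [m] = map \<sigma> (support \<sigma> m)" "m \<notin> set blk"
      using support_Cons[OF permutation_\<sigma>] by blast
    have below: "y < m" if "y \<in> set blk" for y
    proof -
      have "y \<in> orbit \<sigma> m"
        unfolding set_support[symmetric] blk(1) using that by simp
      then have "y \<le> m"
        using \<open>m \<in> set ?ms\<close> orbit_cycle_max[of m] Max_orbit(4)[of m y]
        unfolding set_cycle_maxima by simp
      then show ?thesis using that blk(3) le_neq_implies_less by blast
    qed
    show ?thesis
      by (rule exI[of _ blk], intro conjI ballI, rule blk(1), rule blk(2), rule below)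
  qed
  \<comment> \<open>The scan starts with running maximum 0, which every cycle maximum has to
    exceed.\<close>
  moreover have "\<forall>m \<in> set ?ms. 0 < m"
    using orbit_cycle_max unfolding set_cycle_maxima by fastforce
  moreover have "sorted_wrt (<) ?ms" by simp
  ultimately have "arcs 0 (concat (map (support \<sigma>) ?ms)) =
      map (\<lambda>x. (x, \<sigma> x)) (concat (map (support \<sigma>) ?ms)) \<and>
      lr_maxima 0 (concat (map (support \<sigma>) ?ms)) = length ?ms"
    by (intro arcs_concat_cycles)
  then show "arcs 0 (fundamental_word n \<sigma>) = map (\<lambda>x. (x, \<sigma> x)) (fundamental_word n \<sigma>)"
    "lr_maxima 0 (fundamental_word n \<sigma>) = card (cycle_sets n \<sigma>)"
    by (simp_all only: fundamental_word_def length_cycle_maxima)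
qed

lemma set_fundamental_word: "set (fundamental_word n \<sigma>) = {1..n}"
proof -
  have "set (fundamental_word n \<sigma>) =
      (\<Union>m \<in> set (sorted_list_of_set (Max ` cycle_sets n \<sigma>)). set (support \<sigma> m))"
    by (simp add: fundamental_word_def)
  also have "\<dots> = (\<Union>m \<in> Max ` cycle_sets n \<sigma>. orbit \<sigma> m)"
    unfolding set_cycle_maxima set_support ..
  also have "\<dots> = (\<Union>i \<in> {1..n}. orbit \<sigma> i)"
    using Max_orbit(2) by (simp add: cycle_sets_def)
  also have "\<dots> = {1..n}"
    using Max_orbit(3) permutation_self_in_orbit[OF permutation_\<sigma>] by blast
  finally show ?thesis .
qed

lemma distinct_fundamental_word: "distinct (fundamental_word n \<sigma>)"
  unfolding fundamental_word_def
proof (rule distinct_concat_map[where c = "support \<sigma>"])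
  fix a b
  assume a: "a \<in> set (sorted_list_of_set (Max ` cycle_sets n \<sigma>))"
    and b: "b \<in> set (sorted_list_of_set (Max ` cycle_sets n \<sigma>))" and "a \<noteq> b"
  show "set (support \<sigma> a) \<inter> set (support \<sigma> b) = {}"
    unfolding disjoint_support'[OF permutation_\<sigma>] unfolding set_support
  proof
    assume "a \<in> orbit \<sigma> b"
    moreover have "cyclic_on \<sigma> (orbit \<sigma> b)"
      using permutation_self_in_orbit[OF permutation_\<sigma>] by (auto simp: cyclic_on_def)
    ultimately have "orbit \<sigma> a = orbit \<sigma> b"
      by (simp add: cyclic_on_alldef)
    then show False
      using orbit_cycle_max[of a] orbit_cycle_max[of b] a b \<open>a \<noteq> b\<close>
      unfolding set_cycle_maxima by simp
  qed
next
  fix a assume "a \<in> set (sorted_list_of_set (Max ` cycle_sets n \<sigma>))"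
  show "distinct (support \<sigma> a)" by (rule cycle_of_permutation[OF permutation_\<sigma>])
qed simp

lemma length_fundamental_word: "length (fundamental_word n \<sigma>) = n"
  using distinct_card[OF distinct_fundamental_word] set_fundamental_word by simp

lemma set_arcs_fundamental_word:
  "set (arcs 0 (fundamental_word n \<sigma>)) = (\<lambda>x. (x, \<sigma> x)) ` {1..n}"
  by (simp add: arcs_fundamental_word set_fundamental_word)

lemma depth_eq_height: "depth n \<sigma> = height ((\<lambda>x. (x, \<sigma> x)) ` {1..n})"
proof -
  have "height ((\<lambda>x. (x, \<sigma> x)) ` {1..n}) = (\<Sum>i\<in>{1..n}. \<sigma> i - i)"
    by (simp add: height_def sum.reindex inj_on_def)
  also have "\<dots> = depth n \<sigma>"
    unfolding depth_def by (rule sum.mono_neutral_right) auto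
  finally show ?thesis by simp
qed

lemma inversion_length_eq: "inversion_length n \<sigma> = card (inversions ((\<lambda>x. (x, \<sigma> x)) ` {1..n}))"
proof -
  let ?S = "{(i, j). i \<in> {1..n} \<and> j \<in> {1..n} \<and> i < j \<and> \<sigma> i > \<sigma> j}"
  have "inversions ((\<lambda>x. (x, \<sigma> x)) ` {1..n}) = (\<lambda>(i, j). ((i, \<sigma> i), (j, \<sigma> j))) ` ?S"
    by (auto simp: inversions_def inverted_def image_iff)
  moreover have "inj_on (\<lambda>(i, j). ((i, \<sigma> i), (j, \<sigma> j))) ?S"
    by (auto simp: inj_on_def)
  ultimately show ?thesis by (simp add: inversion_length_def card_image)
qed

text \<open>The word has \<open>n\<close> letters and one left-to-right maximum per cycle, so
  shallowness says that its deficit is zero.\<close>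

lemma shallow_iff_uncrossed: "shallow n \<sigma> \<longleftrightarrow> uncrossed (arcs 0 (fundamental_word n \<sigma>))"
proof -
  have "card (cycle_sets n \<sigma>) \<le> n"
    using card_image_le[of "{1..n}" "orbit \<sigma>"] by (simp add: cycle_sets_def)
  then have "shallow n \<sigma> \<longleftrightarrow> deficit (fundamental_word n \<sigma>) = 0"
    unfolding shallow_def deficit_def set_arcs_fundamental_word arcs_fundamental_word(2)
      length_fundamental_word reflection_length_def depth_eq_height[symmetric]
      inversion_length_eq[symmetric]
    by (simp add: of_nat_diff) linarith
  also have "\<dots> \<longleftrightarrow> uncrossed (arcs 0 (fundamental_word n \<sigma>))"
    using deficit_eq_0_iff[OF distinct_fundamental_word set_fundamental_word] by simp
  finally show ?thesis .
qed

end

subsection \<open>Vincular patterns\<close>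

lemma same_block_Nil: "\<not> same_block [] r s"
  by (simp add: same_block_def)

text \<open>Peels off one block, so that the adjacency conditions of a concrete pattern can be
  evaluated by rewriting.\<close>

lemma same_block_Cons:
  "same_block (b # bs) r s \<longleftrightarrow>
     {r, s} \<subseteq> {0..<length b} \<or>
     length b \<le> r \<and> length b \<le> s \<and> same_block bs (r - length b) (s - length b)"
proof
  assume "same_block (b # bs) r s"
  then obtain us c vs where *: "b # bs = us @ c # vs"
    "{r, s} \<subseteq> {length (concat us) ..< length (concat us) + length c}"
    unfolding same_block_def by blast
  show "{r, s} \<subseteq> {0..<length b} \<or>
     length b \<le> r \<and> length b \<le> s \<and> same_block bs (r - length b) (s - length b)"
  proof (cases us)
    case (Cons u us')
    then have "bs = us' @ c # vs" "length b \<le> r" "length b \<le> s"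
      "{r - length b, s - length b} \<subseteq> {length (concat us') ..< length (concat us') + length c}"
      using * by auto
    then show ?thesis unfolding same_block_def by blast
  qed (use * in auto)
next
  assume "{r, s} \<subseteq> {0..<length b} \<or>
     length b \<le> r \<and> length b \<le> s \<and> same_block bs (r - length b) (s - length b)"
  then show "same_block (b # bs) r s"
  proof
    assume "{r, s} \<subseteq> {0..<length b}"
    then show ?thesis unfolding same_block_def
      by (intro exI[of _ "[]"] exI[of _ b] exI[of _ bs]) auto
  next
    assume *: "length b \<le> r \<and> length b \<le> s \<and> same_block bs (r - length b) (s - length b)"
    then obtain us c vs where "bs = us @ c # vs"
      "{r - length b, s - length b} \<subseteq> {length (concat us) ..< length (concat us) + length c}"
      unfolding same_block_def by blast
    with * show ?thesis unfolding same_block_def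
      by (intro exI[of _ "b # us"] exI[of _ c] exI[of _ vs]) auto
  qed
qed

text \<open>A block of two letters forces positions \<open>k\<close>, \<open>k + 1\<close>, while
  commas leave gaps free; the order conditions reduce to one chain from the smallest letter to the
  largest.\<close>

lemma avoids_5_24_13:
  "\<not> vincular_avoids n \<tau> [[5], [2, 4], [1, 3]] \<longleftrightarrow>
     (\<exists>i k l. 1 \<le> i \<and> i < k \<and> k + 1 < l \<and> l + 1 \<le> n \<and>
        \<tau> l < \<tau> k \<and> \<tau> k < \<tau> (l + 1) \<and> \<tau> (l + 1) < \<tau> (k + 1) \<and> \<tau> (k + 1) < \<tau> i)" (is "_ \<longleftrightarrow> ?R")
proof
  assume "\<not> vincular_avoids n \<tau> [[5], [2, 4], [1, 3]]"
  then obtain ps where occ: "vincular_occurrence n \<tau> [[5], [2, 4], [1, 3]] ps"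
    by (auto simp: vincular_avoids_def)
  then have "length ps = 5" by (simp add: vincular_occurrence_def Let_def)
  then obtain i k k' l l' where ps: "ps = [i, k, k', l, l']"
    by (auto simp: numeral_eq_Suc length_Suc_conv)
  from occ show ?R unfolding ps
    by (auto simp: vincular_occurrence_def Let_def same_block_Cons same_block_Nil All_less_Suc numeral_eq_Suc)
next
  assume ?R
  then obtain i k l where "1 \<le> i" "i < k" "k + 1 < l" "l + 1 \<le> n"
    "\<tau> l < \<tau> k" "\<tau> k < \<tau> (l + 1)" "\<tau> (l + 1) < \<tau> (k + 1)" "\<tau> (k + 1) < \<tau> i" by blast
  then have "vincular_occurrence n \<tau> [[5], [2, 4], [1, 3]] [i, k, k + 1, l, l + 1]"
    by (simp add: vincular_occurrence_def Let_def same_block_Cons same_block_Nil All_less_Suc numeral_eq_Suc)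
  then show "\<not> vincular_avoids n \<tau> [[5], [2, 4], [1, 3]]"
    by (auto simp: vincular_avoids_def)
qed

lemma avoids_4_25_13:
  "\<not> vincular_avoids n \<tau> [[4], [2, 5], [1, 3]] \<longleftrightarrow>
     (\<exists>i k l. 1 \<le> i \<and> i < k \<and> k + 1 < l \<and> l + 1 \<le> n \<and>
        \<tau> l < \<tau> k \<and> \<tau> k < \<tau> (l + 1) \<and> \<tau> (l + 1) < \<tau> i \<and> \<tau> i < \<tau> (k + 1))" (is "_ \<longleftrightarrow> ?R")
proof
  assume "\<not> vincular_avoids n \<tau> [[4], [2, 5], [1, 3]]"
  then obtain ps where occ: "vincular_occurrence n \<tau> [[4], [2, 5], [1, 3]] ps"
    by (auto simp: vincular_avoids_def)
  then have "length ps = 5" by (simp add: vincular_occurrence_def Let_def)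
  then obtain i k k' l l' where ps: "ps = [i, k, k', l, l']"
    by (auto simp: numeral_eq_Suc length_Suc_conv)
  from occ show ?R unfolding ps
    by (auto simp: vincular_occurrence_def Let_def same_block_Cons same_block_Nil All_less_Suc numeral_eq_Suc)
next
  assume ?R
  then obtain i k l where "1 \<le> i" "i < k" "k + 1 < l" "l + 1 \<le> n"
    "\<tau> l < \<tau> k" "\<tau> k < \<tau> (l + 1)" "\<tau> (l + 1) < \<tau> i" "\<tau> i < \<tau> (k + 1)" by blast
  then have "vincular_occurrence n \<tau> [[4], [2, 5], [1, 3]] [i, k, k + 1, l, l + 1]"
    by (simp add: vincular_occurrence_def Let_def same_block_Cons same_block_Nil All_less_Suc numeral_eq_Suc)
  then show "\<not> vincular_avoids n \<tau> [[4], [2, 5], [1, 3]]"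
    by (auto simp: vincular_avoids_def)
qed

lemma avoids_31_42:
  "\<not> vincular_avoids n \<tau> [[3, 1], [4, 2]] \<longleftrightarrow>
     (\<exists>k l. 1 \<le> k \<and> k + 1 < l \<and> l + 1 \<le> n \<and>
        \<tau> (k + 1) < \<tau> (l + 1) \<and> \<tau> (l + 1) < \<tau> k \<and> \<tau> k < \<tau> l)" (is "_ \<longleftrightarrow> ?R")
proof
  assume "\<not> vincular_avoids n \<tau> [[3, 1], [4, 2]]"
  then obtain ps where occ: "vincular_occurrence n \<tau> [[3, 1], [4, 2]] ps"
    by (auto simp: vincular_avoids_def)
  then have "length ps = 4" by (simp add: vincular_occurrence_def Let_def)
  then obtain k k' l l' where ps: "ps = [k, k', l, l']"
    by (auto simp: numeral_eq_Suc length_Suc_conv)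
  from occ show ?R unfolding ps
    by (auto simp: vincular_occurrence_def Let_def same_block_Cons same_block_Nil All_less_Suc numeral_eq_Suc)
next
  assume ?R
  then obtain k l where "1 \<le> k" "k + 1 < l" "l + 1 \<le> n"
    "\<tau> (k + 1) < \<tau> (l + 1)" "\<tau> (l + 1) < \<tau> k" "\<tau> k < \<tau> l" by blast
  then have "vincular_occurrence n \<tau> [[3, 1], [4, 2]] [k, k + 1, l, l + 1]"
    by (simp add: vincular_occurrence_def Let_def same_block_Cons same_block_Nil All_less_Suc numeral_eq_Suc)
  then show "\<not> vincular_avoids n \<tau> [[3, 1], [4, 2]]"
    by (auto simp: vincular_avoids_def)
qed

section \<open>Crossings and patterns by position\<close>

lemma nth_arcs:
  "i < length w \<Longrightarrow> arcs M w ! i = (w ! i, next_val (fold max (take (Suc i) w) M) (drop (Suc i) w))"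
proof (induction w arbitrary: i M)
  case (Cons x w)
  then show ?case by (cases i) (auto simp: max.commute)
qed simp

lemma length_arcs [simp]: "length (arcs M w) = length w"
  by (metis length_map map_fst_arcs)

lemma fold_max_in: "fold max xs M \<in> insert (M :: nat) (set xs)"
proof (induction xs arbitrary: M)
  case (Cons x xs)
  from Cons[of "max x M"] show ?case by (auto simp: max_def split: if_splits)
qed simp

text \<open>The running maximum is attained at some position \<open>p\<close>: as
  \<open>0 < w ! i\<close>, it is not the initial value 0.\<close>

lemma snd_nth_arcs:
  assumes "i < length w" "0 < w ! i"
  shows "\<exists>p \<le> i. (\<forall>r \<le> i. w ! r \<le> w ! p) \<and>
    snd (arcs 0 w ! i) = (if Suc i < length w then min (w ! Suc i) (w ! p) else w ! p)"
proof -
  let ?t = "take (Suc i) w"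
  have le: "w ! r \<le> fold max ?t 0" if "r \<le> i" for r
  proof -
    have "?t ! r \<in> set ?t" using that assms by (intro nth_mem) simp
    then show ?thesis using le_fold_max that by simp
  qed
  then have "fold max ?t 0 \<noteq> 0" using assms(2) by fastforce
  then have "fold max ?t 0 \<in> set ?t" using fold_max_in[of ?t 0] by simp
  then obtain p where p: "p < length ?t" "?t ! p = fold max ?t 0"
    unfolding in_set_conv_nth by blast
  then have *: "p \<le> i" "w ! p = fold max ?t 0" by simp_all
  have "snd (arcs 0 w ! i) = (if Suc i < length w then min (w ! Suc i) (w ! p) else w ! p)"
  proof (cases "Suc i < length w")
    case True
    then have "drop (Suc i) w = w ! Suc i # drop (Suc (Suc i)) w"
      by (rule Cons_nth_drop_Suc[symmetric])
    then show ?thesis using True assms(1) by (simp add: nth_arcs *)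
  qed (use assms(1) in \<open>simp add: nth_arcs *\<close>)
  with * le show ?thesis by auto
qed

text \<open>For arcs at positions \<open>k < l\<close>, the first disjunct of \<open>cross\<close>
  corresponds to \<open>5,24,13\<close> and \<open>4,25,13\<close>, whose leading letter certifies
  that the running maximum at \<open>k\<close> exceeds \<open>w ! (l + 1)\<close>; the second one
  corresponds to \<open>31,42\<close>.\<close>

lemma crossing_iff_pattern:
  assumes "distinct w" "\<forall>x \<in> set w. 0 < x"
  shows "\<not> uncrossed (arcs 0 w) \<longleftrightarrow>
    (\<exists>i k l. i < k \<and> k + 1 < l \<and> l + 1 < length w \<and>
       w ! l < w ! k \<and> w ! k < w ! (l + 1) \<and> w ! (l + 1) < w ! (k + 1) \<and> w ! (k + 1) < w ! i) \<or>
    (\<exists>i k l. i < k \<and> k + 1 < l \<and> l + 1 < length w \<and>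
       w ! l < w ! k \<and> w ! k < w ! (l + 1) \<and> w ! (l + 1) < w ! i \<and> w ! i < w ! (k + 1)) \<or>
    (\<exists>k l. k + 1 < l \<and> l + 1 < length w \<and>
       w ! (k + 1) < w ! (l + 1) \<and> w ! (l + 1) < w ! k \<and> w ! k < w ! l)"
    (is "_ \<longleftrightarrow> ?A \<or> ?B \<or> ?C")
proof -
  let ?L = "arcs 0 w"
  have fst: "fst (?L ! i) = w ! i" if "i < length w" for i
    using that by (simp add: nth_arcs)
  have bad: "\<not> uncrossed ?L \<longleftrightarrow> (\<exists>k l. k < l \<and> l < length w \<and> cross (?L ! k) (?L ! l))"
    by (auto simp: sorted_wrt_iff_nth_less)
  have arc: "\<exists>p \<le> i. (\<forall>r \<le> i. w ! r \<le> w ! p) \<and>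
      snd (?L ! i) = (if Suc i < length w then min (w ! Suc i) (w ! p) else w ! p)"
    if "i < length w" for i
    using snd_nth_arcs[OF that] assms(2) that by simp
  have arc_up: "snd (?L ! k) > v" if k: "k + 1 < length w" and "v < w ! (k + 1)" "i \<le> k" "v < w ! i" for i k v
  proof -
    obtain p where "p \<le> k" "\<forall>r \<le> k. w ! r \<le> w ! p"
      "snd (?L ! k) = (if Suc k < length w then min (w ! Suc k) (w ! p) else w ! p)"
      using arc[OF add_lessD1[OF k]] by blast
    with that show ?thesis using le_less_trans[of "w ! i" "w ! p"] by fastforce
  qed
  \<comment> \<open>A larger letter already read means that position \<open>k + 1\<close> opens no
    new cycle.\<close>
  have arc_next: "snd (?L ! k) = w ! (k + 1)" if k: "k + 1 < length w" and "i \<le> k" "w ! (k + 1) < w ! i" for i k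
  proof -
    obtain p where "p \<le> k" "\<forall>r \<le> k. w ! r \<le> w ! p"
      "snd (?L ! k) = (if Suc k < length w then min (w ! Suc k) (w ! p) else w ! p)"
      using arc[OF add_lessD1[OF k]] by blast
    with that show ?thesis by (metis Suc_eq_plus1 less_imp_le less_le_trans min.absorb1)
  qed
  show ?thesis
  proof
    assume "\<not> uncrossed ?L"
    then obtain k l where kl: "k < l" "l < length w" "cross (?L ! k) (?L ! l)"
      unfolding bad by blast
    obtain p where p: "p \<le> k" "\<forall>r \<le> k. w ! r \<le> w ! p"
      "snd (?L ! k) = (if Suc k < length w then min (w ! Suc k) (w ! p) else w ! p)"
      using arc[of k] kl(1,2) less_trans by blast
    obtain q where q: "q \<le> l" "\<forall>r \<le> l. w ! r \<le> w ! q"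
      "snd (?L ! l) = (if Suc l < length w then min (w ! Suc l) (w ! q) else w ! q)"
      using arc[of l] kl(2) by blast
    have Sk: "Suc k < length w" using kl by simp
    have pq: "w ! p \<le> w ! q" using q(2) p(1) kl(1) by simp
    from kl(3) consider
      (up) "w ! l < w ! k" "w ! k < snd (?L ! l)" "snd (?L ! l) < snd (?L ! k)" |
      (down) "snd (?L ! k) < snd (?L ! l)" "snd (?L ! l) < w ! k" "w ! k < w ! l"
      using fst kl by (auto simp: cross_def)
    then show "?A \<or> ?B \<or> ?C"
    proof cases
      case up
      have "snd (?L ! l) < w ! q" using up(3) pq p(3) Sk by simp
      then have l: "Suc l < length w" "snd (?L ! l) = w ! Suc l"
        using q(3) by (auto simp: min_def split: if_splits)
      have k: "w ! Suc l < w ! Suc k" "w ! Suc l < w ! p"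
        using up(3) p(3) Sk l(2) by simp_all
      \<comment> \<open>The maximum so far exceeds \<open>w ! (l + 1)\<close> while
        \<open>w ! k\<close> does not, so it sits strictly before \<open>k\<close> and can serve as
        the leading letter.\<close>
      have "p < k" using p(1) up(2) k(2) l(2) by (cases "p = k") auto
      \<comment> \<open>The blocks cannot overlap: \<open>l = k + 1\<close> would give
        \<open>w ! l > w ! k\<close>, contrary to the crossing.\<close>
      have "Suc k < l"
        using kl(1) up k l by (cases "Suc k = l") auto
      have "w ! p \<noteq> w ! Suc k"
        using assms(1) Sk \<open>p < k\<close> by (simp add: nth_eq_iff_index_eq)
      then consider "w ! Suc k < w ! p" | "w ! p < w ! Suc k" by linarith
      then show ?thesis
      proof cases
        case 1
        then have ?A using \<open>p < k\<close> \<open>Suc k < l\<close> l k up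
          by (intro exI[of _ p] exI[of _ k] exI[of _ l]) simp
        then show ?thesis by blast
      next
        case 2
        then have ?B using \<open>p < k\<close> \<open>Suc k < l\<close> l k up
          by (intro exI[of _ p] exI[of _ k] exI[of _ l]) simp
        then show ?thesis by blast
      qed
    next
      case down
      have "snd (?L ! l) < w ! q" using down(2,3) q(2) by (metis le_less_trans less_trans order_refl less_le_trans)
      then have l: "Suc l < length w" "snd (?L ! l) = w ! Suc l"
        using q(3) by (auto simp: min_def split: if_splits)
      have "snd (?L ! k) < w ! p" using down p(2) by (metis less_trans order_refl less_le_trans)
      then have k: "snd (?L ! k) = w ! Suc k"
        using p(3) Sk by (auto simp: min_def split: if_splits)
      have "Suc k < l" using kl(1) down k by (cases "Suc k = l") auto
      then have ?C using l k down by (intro exI[of _ k] exI[of _ l]) simp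
      then show ?thesis by blast
    qed
  next
    have upI: "\<not> uncrossed ?L"
      if "i < k" "k + 1 < l" "l + 1 < length w" "w ! l < w ! k" "w ! k < w ! (l + 1)"
        "w ! (l + 1) < w ! (k + 1)" "w ! (l + 1) < w ! i" for i k l
    proof -
      have "snd (?L ! l) = w ! (l + 1)" using arc_next[of l i] that by simp
      moreover have "w ! (l + 1) < snd (?L ! k)" using arc_up[of k "w ! (l + 1)" i] that by simp
      ultimately have "cross (?L ! k) (?L ! l)" using fst that by (simp add: cross_def)
      then show ?thesis unfolding bad using that by (intro exI[of _ k] exI[of _ l]) simp
    qed
    have downI: "\<not> uncrossed ?L"
      if "k + 1 < l" "l + 1 < length w" "w ! (k + 1) < w ! (l + 1)" "w ! (l + 1) < w ! k"
        "w ! k < w ! l" for k l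
    proof -
      have "snd (?L ! l) = w ! (l + 1)" using arc_next[of l l] that by simp
      moreover have "snd (?L ! k) = w ! (k + 1)" using arc_next[of k k] that by simp
      ultimately have "cross (?L ! k) (?L ! l)" using fst that by (simp add: cross_def)
      then show ?thesis unfolding bad using that by (intro exI[of _ k] exI[of _ l]) simp
    qed
    assume "?A \<or> ?B \<or> ?C"
    then consider ?A | ?B | ?C by blast
    then show "\<not> uncrossed ?L"
    proof cases
      case 1
      then show ?thesis using upI by (meson less_trans)
    next
      case 2
      then show ?thesis using upI by (meson less_trans)
    next
      case 3
      then show ?thesis using downI by blast
    qed
  qed
qed

theorem theorem4p7:
  fixes n :: nat and \<sigma> :: "nat \<Rightarrow> nat"
  assumes "\<sigma> permutes {1..n}"
  shows "shallow n \<sigma> \<longleftrightarrow>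
           vincular_avoids n (fundamental_bij n \<sigma>) [[5], [2, 4], [1, 3]] \<and>
           vincular_avoids n (fundamental_bij n \<sigma>) [[4], [2, 5], [1, 3]] \<and>
           vincular_avoids n (fundamental_bij n \<sigma>) [[3, 1], [4, 2]]"
proof -
  let ?w = "fundamental_word n \<sigma>" and ?t = "fundamental_bij n \<sigma>"
  note len = length_fundamental_word[OF assms]
  have t: "?t (Suc i) = ?w ! i" if "i < n" for i
    using that by (simp add: fundamental_bij_def)
  \<comment> \<open>Positions of \<open>?t\<close> count from 1, those of \<open>?w\<close> from 0;
    the shift turns \<open>l + 1 \<le> n\<close> into \<open>l + 1 < n\<close>.\<close>
  have shift: "(\<exists>i k l. 1 \<le> i \<and> i < k \<and> k + 1 < l \<and> l + 1 \<le> n \<and>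
        Q (?t i) (?t k) (?t (k + 1)) (?t l) (?t (l + 1))) \<longleftrightarrow>
      (\<exists>i k l. i < k \<and> k + 1 < l \<and> l + 1 < n \<and>
        Q (?w ! i) (?w ! k) (?w ! (k + 1)) (?w ! l) (?w ! (l + 1)))"
    (is "?l \<longleftrightarrow> ?r") for Q :: "nat \<Rightarrow> nat \<Rightarrow> nat \<Rightarrow> nat \<Rightarrow> nat \<Rightarrow> bool"
  proof
    assume ?l
    then obtain i k l where *: "1 \<le> i" "i < k" "k + 1 < l" "l + 1 \<le> n"
      "Q (?t i) (?t k) (?t (k + 1)) (?t l) (?t (l + 1))" by blast
    then obtain i' k' l' where "i = Suc i'" "k = Suc k'" "l = Suc l'"
      by (metis Suc_le_D One_nat_def less_imp_Suc_add)
    with * show ?r by (intro exI[of _ i'] exI[of _ k'] exI[of _ l']) (simp add: t)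
  next
    assume ?r
    then obtain i k l where "i < k" "k + 1 < l" "l + 1 < n"
      "Q (?w ! i) (?w ! k) (?w ! (k + 1)) (?w ! l) (?w ! (l + 1))" by blast
    then show ?l by (intro exI[of _ "Suc i"] exI[of _ "Suc k"] exI[of _ "Suc l"]) (simp add: t)
  qed
  have shift': "(\<exists>k l. 1 \<le> k \<and> k + 1 < l \<and> l + 1 \<le> n \<and>
        Q (?t k) (?t (k + 1)) (?t l) (?t (l + 1))) \<longleftrightarrow>
      (\<exists>k l. k + 1 < l \<and> l + 1 < n \<and> Q (?w ! k) (?w ! (k + 1)) (?w ! l) (?w ! (l + 1)))"
    (is "?l \<longleftrightarrow> ?r") for Q :: "nat \<Rightarrow> nat \<Rightarrow> nat \<Rightarrow> nat \<Rightarrow> bool"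
  proof
    assume ?l
    then obtain k l where *: "1 \<le> k" "k + 1 < l" "l + 1 \<le> n"
      "Q (?t k) (?t (k + 1)) (?t l) (?t (l + 1))" by blast
    then obtain k' l' where "k = Suc k'" "l = Suc l'"
      by (metis Suc_le_D One_nat_def less_imp_Suc_add)
    with * show ?r by (intro exI[of _ k'] exI[of _ l']) (simp add: t)
  next
    assume ?r
    then obtain k l where "k + 1 < l" "l + 1 < n"
      "Q (?w ! k) (?w ! (k + 1)) (?w ! l) (?w ! (l + 1))" by blast
    then show ?l by (intro exI[of _ "Suc k"] exI[of _ "Suc l"]) (simp add: t)
  qed
  have "\<forall>x \<in> set ?w. 0 < x" using set_fundamental_word[OF assms] by simp
  note crossing = crossing_iff_pattern[OF distinct_fundamental_word[OF assms] this, unfolded len]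
  have "\<not> shallow n \<sigma> \<longleftrightarrow>
      \<not> vincular_avoids n ?t [[5], [2, 4], [1, 3]] \<or>
      \<not> vincular_avoids n ?t [[4], [2, 5], [1, 3]] \<or>
      \<not> vincular_avoids n ?t [[3, 1], [4, 2]]"
    unfolding shallow_iff_uncrossed[OF assms] crossing avoids_5_24_13 avoids_4_25_13 avoids_31_42
    unfolding shift[of "\<lambda>a b c d e. d < b \<and> b < e \<and> e < c \<and> c < a"]
      shift[of "\<lambda>a b c d e. d < b \<and> b < e \<and> e < a \<and> a < c"]
      shift'[of "\<lambda>b c d e. c < e \<and> e < b \<and> b < d"] ..
  then show ?thesis by blast
qed

end
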